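(* The Gaussian and mean curvatures of an admissible parabolic revolution surface of ni-type in $\mathbb{I}^3_{\mathrm{p}}$, $$Yh_3(u,t)=\left(at+x(u),\ bt+y(u),\ ct+\tfrac{ac_1+bc_2}{2}t^2+c_1t\,x(u)+c_2t\,y(u)\right),$$ with $C^2$ generating curve $\alpha(u)=(x(u),y(u),0)$, are respectively $$K=\left(\frac{c_1x'+c_2y'}{bx'-ay'}\right)^2-\frac{(ac_1+bc_2)(c+c_1x+c_2y)}{(bx'-ay')^3}(x''y'-x'y'')$$ and $$H=-\frac{(a^2-b^2)(c+c_1x+c_2y)(x''y'-x'y'')}{2(bx'-ay')^3}+\frac{(ax'-by')(c_1x'+c_2y')}{(bx'-ay')^2}-\frac{(x'^2-y'^2)(ac_1+bc_2)}{2(bx'-ay')^2}.$$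
   Context: Here $a,b,c,c_1,c_2\in\mathbb{R}$ are constants with $ac_1+bc_2\neq0$ (the defining condition of pseudo-parabolic rotations), and primes denote $d/du$. The pseudo-isotropic space $\mathbb{I}^3_{\mathrm{p}}$ is $\mathbb{R}^3$ with the degenerate metric $\langle u,v\rangle_{pz}=u^1v^1-u^2v^2$. For a $C^2$ parameterized surface $\mathbf{x}(u^1,u^2)=(x^1,x^2,x^3)$ write $\mathbf{x}_i=\partial\mathbf{x}/\partial u^i$, $\mathbf{x}_{ij}=\partial^2\mathbf{x}/\partial u^i\partial u^j$, $x^i_k=\partial x^i/\partial u^k$, $X_{ij}=x^i_1x^j_2-x^j_1x^i_2$. The surface is admissible if $X_{12}\neq0$ (equivalently, the induced metric has rank 2). Put $g_{ij}=\langle\mathbf{x}_i,\mathbf{x}_j\rangle_{pz}$, $N_h=\left(\frac{X_{23}}{X_{12}},\frac{X_{13}}{X_{12}},1\right)$, $h_{ij}=\langle N_h,\mathbf{x}_{ij}\rangle_1$, where $\langle u,v\rangle_1=u^1v^1-u^2v^2+u^3v^3$. The Gaussian and mean curvatures are $$K=\frac{h_{11}h_{22}-h_{12}^2}{g_{11}g_{22}-g_{12}^2},\qquad H=\frac12\,\frac{g_{11}h_{22}-2g_{12}h_{12}+g_{22}h_{11}}{g_{11}g_{22}-g_{12}^2};$$ equivalently $K=\det L$, $H=\frac12\mathrm{tr}\,L$ with $L=-D\xi^{\mathrm p}$, $\xi^{\mathrm p}=\left(A,B,\frac12(1-A^2+B^2)\right)$, $A=X_{23}/X_{12}$, $B=X_{13}/X_{12}$.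 For the surface in the claim the coordinates are $(u^1,u^2)=(u,t)$. *)

theory Defs
  imports "HOL-Analysis.Analysis"
begin

text \<open>
  The pseudo-isotropic space is \<^typ>\<open>real^3\<close> with the degenerate metric \<open>pz_inner\<close>;
  a parameterized surface is a map \<^typ>\<open>real^2 \<Rightarrow> real^3\<close> of the coordinates
  \<open>(u\<^sup>1, u\<^sup>2)\<close>.  Indices are elements of the types \<open>2\<close> and \<open>3\<close>.
\<close>

definition pz_inner :: "real^3 \<Rightarrow> real^3 \<Rightarrow> real"
  where "pz_inner v w = v$1 * w$1 - v$2 * w$2"

definition inner_1 :: "real^3 \<Rightarrow> real^3 \<Rightarrow> real"
  where "inner_1 v w = v$1 * w$1 - v$2 * w$2 + v$3 * w$3"

definition partial :: "2 \<Rightarrow> (real^2 \<Rightarrow> real^3) \<Rightarrow> real^2 \<Rightarrow> real^3"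
  where "partial i X p = vector_derivative (\<lambda>s. X (p + s *\<^sub>R axis i 1)) (at 0)"

definition minor :: "(real^2 \<Rightarrow> real^3) \<Rightarrow> 3 \<Rightarrow> 3 \<Rightarrow> real^2 \<Rightarrow> real"
  where "minor X i j p =
    partial 1 X p $ i * partial 2 X p $ j - partial 1 X p $ j * partial 2 X p $ i"

definition admissible_on :: "(real^2) set \<Rightarrow> (real^2 \<Rightarrow> real^3) \<Rightarrow> bool"
  where "admissible_on D X \<longleftrightarrow> (\<forall>p\<in>D. minor X 1 2 p \<noteq> 0)"

definition first_form :: "(real^2 \<Rightarrow> real^3) \<Rightarrow> 2 \<Rightarrow> 2 \<Rightarrow> real^2 \<Rightarrow> real"
  where "first_form X i j p = pz_inner (partial i X p) (partial j X p)"

definition normal_h :: "(real^2 \<Rightarrow> real^3) \<Rightarrow> real^2 \<Rightarrow> real^3"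
  where "normal_h X p =
    vector [minor X 2 3 p / minor X 1 2 p, minor X 1 3 p / minor X 1 2 p, 1]"

definition second_form :: "(real^2 \<Rightarrow> real^3) \<Rightarrow> 2 \<Rightarrow> 2 \<Rightarrow> real^2 \<Rightarrow> real"
  where "second_form X i j p = inner_1 (normal_h X p) (partial j (partial i X) p)"

definition Gaussian_curvature :: "(real^2 \<Rightarrow> real^3) \<Rightarrow> real^2 \<Rightarrow> real"
  where "Gaussian_curvature X p =
    (second_form X 1 1 p * second_form X 2 2 p - (second_form X 1 2 p)\<^sup>2) /
    (first_form X 1 1 p * first_form X 2 2 p - (first_form X 1 2 p)\<^sup>2)"

definition mean_curvature :: "(real^2 \<Rightarrow> real^3) \<Rightarrow> real^2 \<Rightarrow> real"
  where "mean_curvature X p = 1/2 *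
    ((first_form X 1 1 p * second_form X 2 2 p
        - 2 * first_form X 1 2 p * second_form X 1 2 p
        + first_form X 2 2 p * second_form X 1 1 p) /
     (first_form X 1 1 p * first_form X 2 2 p - (first_form X 1 2 p)\<^sup>2))"

text \<open>Meant for open parameter intervals, where two-sided derivatives are the right ones.\<close>

definition C2_curve_on :: "real set \<Rightarrow> (real \<Rightarrow> real^3) \<Rightarrow> bool"
  where "C2_curve_on I \<alpha> \<longleftrightarrow>
    \<alpha> C1_differentiable_on I \<and> (\<lambda>u. vector_derivative \<alpha> (at u)) C1_differentiable_on I"

text \<open>
  Revolution surface of ni-type generated by the curve \<open>\<alpha>(u) = (x(u), y(u), 0)\<close>;
  the coordinates are \<open>p $ 1 = u\<close> and \<open>p $ 2 = t\<close>.
\<close>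

definition ni_curve :: "(real \<Rightarrow> real) \<Rightarrow> (real \<Rightarrow> real) \<Rightarrow> real \<Rightarrow> real^3"
  where "ni_curve x y u = vector [x u, y u, 0]"

definition Yh3 ::
  "real \<Rightarrow> real \<Rightarrow> real \<Rightarrow> real \<Rightarrow> real \<Rightarrow> (real \<Rightarrow> real) \<Rightarrow> (real \<Rightarrow> real) \<Rightarrow> real^2 \<Rightarrow> real^3"
  where "Yh3 a b c c1 c2 x y p = (let u = p$1; t = p$2 in
    vector [a * t + x u,
            b * t + y u,
            c * t + (a * c1 + b * c2) / 2 * t\<^sup>2 + c1 * t * x u + c2 * t * y u])"

end

theory Submission imports Defs begin

text \<open>
  Both formulas come from evaluating the two fundamental forms of the surface. Write
  \<open>m = a c1 + b c2\<close>, \<open>w = c1 x' + c2 y'\<close>, \<open>P = c + c1 x + c2 y\<close>,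
  \<open>E = x'' y' - x' y''\<close> and \<open>d = b x' - a y'\<close>. Differentiating twice, one finds
  \<open>X\<^sub>1\<^sub>2 = d\<close>, \<open>h\<^sub>1\<^sub>2 = w\<close> and \<open>h\<^sub>2\<^sub>2 = m\<close>, because the mixed and the second
  \<open>t\<close>-derivative have only a third component. The first form depends on \<open>u\<close> alone, being that
  of \<open>(u, t) \<mapsto> (a t + x, b t + y)\<close> in the Lorentz plane, and its determinant is \<open>- d\<^sup>2\<close>.

  The one coefficient in which \<open>t\<close> could survive is \<open>h\<^sub>1\<^sub>1\<close>. It does not, because of the identity
  \<open>d (c1 x'' + c2 y'') - w (b x'' - a y'') = - m E\<close>: the terms linear in \<open>t\<close>
  cancel and \<open>h\<^sub>1\<^sub>1 = P E / d\<close> remains. Hence \<open>K = (m P E / d - w\<^sup>2) / (- d\<^sup>2)\<close>, and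
  likewise for \<open>H\<close>, which are the asserted expressions. Independence of \<open>t\<close> was to be expected:
  the \<open>t\<close>-curves are orbits of a one-parameter group of motions.

  The analytic part of the proof reads off the smoothness of \<open>x\<close> and \<open>y\<close>
  from that of the space curve and justifies the iterated partial derivatives, for which the
  formula of the first derivative is available only above the parameter interval.
\<close>

section \<open>Derivatives of vectors and partial derivatives\<close>

lemma has_vector_derivative_vector_3:
  fixes f g h :: "real \<Rightarrow> real"
  assumes "(f has_real_derivative f') (at u)"
    and "(g has_real_derivative g') (at u)"
    and "(h has_real_derivative h') (at u)"
  shows "((\<lambda>u. vector [f u, g u, h u] :: real^3) has_vector_derivative vector [f', g', h']) (at u)"
proof -
  have vec: "(vector [p, q, r] :: real^3) = p *\<^sub>R axis 1 1 + q *\<^sub>R axis 2 1 + r *\<^sub>R axis 3 1"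
    for p q r :: real
    by (simp add: vec_eq_iff forall_3 axis_def)
  show ?thesis
    unfolding vec using assms by (auto intro!: derivative_eq_intros)
qed

lemma has_real_derivative_component:
  assumes "(f has_vector_derivative f') (at u)"
  shows "((\<lambda>u. f u $ i) has_real_derivative f' $ i) (at u)"
  using bounded_linear.has_vector_derivative[OF bounded_linear_vec_nth assms]
  by (simp add: has_real_derivative_iff_has_vector_derivative)

text \<open>
  A slice need be known only locally: second partial derivatives in the first direction are taken
  of a function whose formula holds only for parameters in the interval.
\<close>

lemma partial_1_eqI:
  assumes "open I" "u \<in> I"
    and eq: "\<And>v. v \<in> I \<Longrightarrow> X (vector [v, t]) = f v"
    and "(f has_vector_derivative D) (at u)"
  shows "partial 1 X (vector [u, t]) = D"
proof -
  have "((\<lambda>v. X (vector [v, t])) has_vector_derivative D) (at u)"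
    using has_vector_derivative_transform_within_open[OF assms(4,1,2)] eq by auto
  then have "((\<lambda>v. X (vector [v, t])) \<circ> (\<lambda>s. u + s) has_vector_derivative 1 *\<^sub>R D) (at 0)"
    by (intro vector_diff_chain_at) (auto intro!: derivative_eq_intros)
  moreover have "vector [u, t] + s *\<^sub>R axis 1 1 = (vector [u + s, t] :: real^2)" for s
    by (simp add: vec_eq_iff forall_2 axis_def)
  ultimately show ?thesis
    by (simp add: partial_def o_def vector_derivative_at)
qed

lemma partial_2_eqI:
  assumes eq: "\<And>s. X (vector [u, s]) = f s"
    and "(f has_vector_derivative D) (at t)"
  shows "partial 2 X (vector [u, t]) = D"
proof -
  have "(f \<circ> (\<lambda>s. t + s) has_vector_derivative 1 *\<^sub>R D) (at 0)"
    using assms(2) by (intro vector_diff_chain_at) (auto intro!: derivative_eq_intros)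
  moreover have "vector [u, t] + s *\<^sub>R axis 2 1 = (vector [u, t + s] :: real^2)" for s
    by (simp add: vec_eq_iff forall_2 axis_def)
  ultimately show ?thesis
    by (simp add: partial_def o_def eq vector_derivative_at)
qed

section \<open>Smoothness of the generating curve\<close>

lemma C1_ni_curve_derivatives:
  assumes "ni_curve x y C1_differentiable_on I" "u \<in> I"
  shows "(x has_real_derivative deriv x u) (at u)"
    and "(y has_real_derivative deriv y u) (at u)"
    and "vector_derivative (ni_curve x y) (at u) = vector [deriv x u, deriv y u, 0]"
proof -
  obtain D where D: "(ni_curve x y has_vector_derivative D) (at u)"
    using assms by (auto simp: C1_differentiable_on_def)
  note comp = has_real_derivative_component[OF D, unfolded ni_curve_def]
  have x: "(x has_real_derivative D $ 1) (at u)" and y: "(y has_real_derivative D $ 2) (at u)"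
    and z: "((\<lambda>u. 0) has_real_derivative D $ 3) (at u)"
    using comp[of 1] comp[of 2] comp[of 3] by simp_all
  then show "(x has_real_derivative deriv x u) (at u)"
    "(y has_real_derivative deriv y u) (at u)"
    by (simp_all add: DERIV_imp_deriv)
  have "D $ 3 = 0"
    using DERIV_unique[OF z DERIV_const] .
  then have "D = vector [deriv x u, deriv y u, 0]"
    using x y by (simp add: vec_eq_iff forall_3 DERIV_imp_deriv)
  then show "vector_derivative (ni_curve x y) (at u) = vector [deriv x u, deriv y u, 0]"
    using D by (simp add: vector_derivative_at)
qed

text \<open>
  The velocity of a curve in the plane \<open>z = 0\<close> is, over \<open>I\<close>, again a curve in this
  plane, with components the derivatives of the original components; so the first-order lemma
  applies a second time.
\<close>

lemma C2_ni_curve_derivatives: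
  assumes "open I" "C2_curve_on I (ni_curve x y)" "u \<in> I"
  shows "(x has_real_derivative deriv x u) (at u)"
    and "(y has_real_derivative deriv y u) (at u)"
    and "(deriv x has_real_derivative deriv (deriv x) u) (at u)"
    and "(deriv y has_real_derivative deriv (deriv y) u) (at u)"
proof -
  have C1: "ni_curve x y C1_differentiable_on I"
    and C1': "(\<lambda>u. vector_derivative (ni_curve x y) (at u)) C1_differentiable_on I"
    using assms(2) by (auto simp: C2_curve_on_def)
  obtain D where D: "continuous_on I D"
      "\<And>v. v \<in> I \<Longrightarrow>
        ((\<lambda>u. vector_derivative (ni_curve x y) (at u)) has_vector_derivative D v) (at v)"
    using C1' by (auto simp: C1_differentiable_on_def)
  have "(ni_curve (deriv x) (deriv y) has_vector_derivative D v) (at v)" if "v \<in> I" for v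
    by (rule has_vector_derivative_transform_within_open[OF D(2)[OF that] assms(1) that])
      (simp add: C1_ni_curve_derivatives(3)[OF C1] ni_curve_def)
  then have C1'': "ni_curve (deriv x) (deriv y) C1_differentiable_on I"
    using D(1) by (auto simp: C1_differentiable_on_def)
  show "(x has_real_derivative deriv x u) (at u)"
    "(y has_real_derivative deriv y u) (at u)"
    "(deriv x has_real_derivative deriv (deriv x) u) (at u)"
    "(deriv y has_real_derivative deriv (deriv y) u) (at u)"
    using C1_ni_curve_derivatives(1,2)[OF C1 assms(3)]
      C1_ni_curve_derivatives(1,2)[OF C1'' assms(3)] by auto
qed

section \<open>The fundamental forms of the revolution surface\<close>

lemma Yh3_vector:
  "Yh3 a b c c1 c2 x y (vector [u, t]) =
    vector [a * t + x u, b * t + y u,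
      c * t + (a * c1 + b * c2) / 2 * t\<^sup>2 + c1 * t * x u + c2 * t * y u]"
  by (simp add: Yh3_def Let_def)

lemma partial_1_Yh3:
  assumes "(x has_real_derivative x') (at u)" "(y has_real_derivative y') (at u)"
  shows "partial 1 (Yh3 a b c c1 c2 x y) (vector [u, t]) =
    vector [x', y', t * (c1 * x' + c2 * y')]"
  by (rule partial_1_eqI[OF open_UNIV UNIV_I], rule Yh3_vector, rule has_vector_derivative_vector_3)
    (use assms in \<open>auto intro!: derivative_eq_intros simp: algebra_simps\<close>)

lemma partial_2_Yh3:
  "partial 2 (Yh3 a b c c1 c2 x y) (vector [u, t]) =
    vector [a, b, c + (a * c1 + b * c2) * t + c1 * x u + c2 * y u]"
  by (rule partial_2_eqI, rule Yh3_vector, rule has_vector_derivative_vector_3)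
    (auto intro!: derivative_eq_intros simp: algebra_simps)

lemma partial_11_Yh3:
  assumes "open I" "C2_curve_on I (ni_curve x y)" "u \<in> I"
  shows "partial 1 (partial 1 (Yh3 a b c c1 c2 x y)) (vector [u, t]) =
    vector [deriv (deriv x) u, deriv (deriv y) u,
      t * (c1 * deriv (deriv x) u + c2 * deriv (deriv y) u)]"
proof (rule partial_1_eqI[OF assms(1,3)])
  fix v assume "v \<in> I"
  then show "partial 1 (Yh3 a b c c1 c2 x y) (vector [v, t]) =
      vector [deriv x v, deriv y v, t * (c1 * deriv x v + c2 * deriv y v)]"
    using C2_ni_curve_derivatives(1,2)[OF assms(1,2)] by (intro partial_1_Yh3)
next
  show "((\<lambda>v. vector [deriv x v, deriv y v, t * (c1 * deriv x v + c2 * deriv y v)] :: real^3)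
      has_vector_derivative
      vector [deriv (deriv x) u, deriv (deriv y) u,
        t * (c1 * deriv (deriv x) u + c2 * deriv (deriv y) u)]) (at u)"
    using C2_ni_curve_derivatives(3,4)[OF assms]
    by (intro has_vector_derivative_vector_3) (auto intro!: derivative_eq_intros)
qed

lemma partial_12_Yh3:
  assumes "(x has_real_derivative x') (at u)" "(y has_real_derivative y') (at u)"
  shows "partial 2 (partial 1 (Yh3 a b c c1 c2 x y)) (vector [u, t]) =
    vector [0, 0, c1 * x' + c2 * y']"
  by (rule partial_2_eqI, rule partial_1_Yh3[OF assms], rule has_vector_derivative_vector_3)
    (auto intro!: derivative_eq_intros)

lemma partial_22_Yh3:
  "partial 2 (partial 2 (Yh3 a b c c1 c2 x y)) (vector [u, t]) =
    vector [0, 0, a * c1 + b * c2]"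
  by (rule partial_2_eqI, rule partial_2_Yh3, rule has_vector_derivative_vector_3)
    (auto intro!: derivative_eq_intros)

lemma minor_12_Yh3:
  assumes "(x has_real_derivative x') (at u)" "(y has_real_derivative y') (at u)"
  shows "minor (Yh3 a b c c1 c2 x y) 1 2 (vector [u, t]) = b * x' - a * y'"
  by (simp add: minor_def partial_1_Yh3[OF assms] partial_2_Yh3)

lemma first_form_Yh3:
  assumes "(x has_real_derivative x') (at u)" "(y has_real_derivative y') (at u)"
  shows "first_form (Yh3 a b c c1 c2 x y) 1 1 (vector [u, t]) = x'\<^sup>2 - y'\<^sup>2"
    and "first_form (Yh3 a b c c1 c2 x y) 1 2 (vector [u, t]) = a * x' - b * y'"
    and "first_form (Yh3 a b c c1 c2 x y) 2 2 (vector [u, t]) = a\<^sup>2 - b\<^sup>2"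
  by (simp_all add: first_form_def pz_inner_def partial_1_Yh3[OF assms] partial_2_Yh3
      power2_eq_square)

lemma second_form_12_22_Yh3:
  assumes "(x has_real_derivative x') (at u)" "(y has_real_derivative y') (at u)"
  shows "second_form (Yh3 a b c c1 c2 x y) 1 2 (vector [u, t]) = c1 * x' + c2 * y'"
    and "second_form (Yh3 a b c c1 c2 x y) 2 2 (vector [u, t]) = a * c1 + b * c2"
  by (simp_all add: second_form_def inner_1_def normal_h_def partial_12_Yh3[OF assms]
      partial_22_Yh3)

text \<open>
  Multiplied by \<open>b x' - a y'\<close>, the coefficient is a polynomial in \<open>t\<close> of degree one
  whose linear terms cancel; admissibility is what allows the division.
\<close>

lemma second_form_11_Yh3:
  assumes "open I" "C2_curve_on I (ni_curve x y)" "u \<in> I"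
    and "b * deriv x u - a * deriv y u \<noteq> 0"
  shows "second_form (Yh3 a b c c1 c2 x y) 1 1 (vector [u, t]) =
    (c + c1 * x u + c2 * y u) *
      (deriv (deriv x) u * deriv y u - deriv x u * deriv (deriv y) u) /
      (b * deriv x u - a * deriv y u)"
proof -
  note d = C2_ni_curve_derivatives(1,2)[OF assms(1-3)]
  show ?thesis
    using assms(4)
    by (simp add: second_form_def inner_1_def normal_h_def partial_11_Yh3[OF assms(1-3)]
        minor_12_Yh3[OF d])
      (simp add: minor_def partial_1_Yh3[OF d] partial_2_Yh3 divide_simps, simp add: algebra_simps)
qed

section \<open>The curvatures\<close>

text \<open>
  Lagrange's identity for the Lorentz form of the plane; the determinant of the induced metric
  is therefore minus the square of \<open>X\<^sub>1\<^sub>2\<close>.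
\<close>

lemma lorentz_gram_determinant:
  fixes a b p q :: real
  shows "(p\<^sup>2 - q\<^sup>2) * (a\<^sup>2 - b\<^sup>2) - (a * p - b * q)\<^sup>2 = - (b * p - a * q)\<^sup>2"
  by algebra

theorem proposition6p3:
  fixes a b c c1 c2 :: real and x y :: "real \<Rightarrow> real" and I :: "real set"
  assumes "a * c1 + b * c2 \<noteq> 0"
    and "open I" and "is_interval I"
    and "C2_curve_on I (ni_curve x y)"
    and "admissible_on {p. p$1 \<in> I} (Yh3 a b c c1 c2 x y)"
  shows "\<forall>u\<in>I. \<forall>t.
    (let S = Yh3 a b c c1 c2 x y; p = vector [u, t] :: real^2;
         X = x u; Y = y u; X' = deriv x u; Y' = deriv y u;
         X'' = deriv (deriv x) u; Y'' = deriv (deriv y) u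
     in Gaussian_curvature S p =
          ((c1 * X' + c2 * Y') / (b * X' - a * Y'))\<^sup>2
          - (a * c1 + b * c2) * (c + c1 * X + c2 * Y) / (b * X' - a * Y')^3
            * (X'' * Y' - X' * Y'')
      \<and> mean_curvature S p =
          - ((a\<^sup>2 - b\<^sup>2) * (c + c1 * X + c2 * Y) * (X'' * Y' - X' * Y'')
             / (2 * (b * X' - a * Y')^3))
          + (a * X' - b * Y') * (c1 * X' + c2 * Y') / (b * X' - a * Y')\<^sup>2
          - (X'\<^sup>2 - Y'\<^sup>2) * (a * c1 + b * c2) / (2 * (b * X' - a * Y')\<^sup>2))"
proof (intro ballI allI)
  fix u t assume u: "u \<in> I"
  note d = C2_ni_curve_derivatives(1,2)[OF assms(2,4) u]
  have "minor (Yh3 a b c c1 c2 x y) 1 2 (vector [u, t]) \<noteq> 0"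
    using assms(5) u by (simp add: admissible_on_def)
  then have nz: "b * deriv x u - a * deriv y u \<noteq> 0"
    by (simp add: minor_12_Yh3[OF d])
  note forms = first_form_Yh3[OF d] second_form_12_22_Yh3[OF d]
    second_form_11_Yh3[OF assms(2,4) u nz] lorentz_gram_determinant
  \<comment> \<open>The denominator is kept as an atom: expanding it would hide the common factors.\<close>
  define \<delta> where "\<delta> = b * deriv x u - a * deriv y u"
  have K: "(P * E / \<delta> * m - w\<^sup>2) / (- \<delta>\<^sup>2) = (w / \<delta>)\<^sup>2 - m * P / \<delta>^3 * E"
    and H: "1/2 * ((g * m - 2 * k * w + n * (P * E / \<delta>)) / (- \<delta>\<^sup>2)) =
      - (n * P * E / (2 * \<delta>^3)) + k * w / \<delta>\<^sup>2 - g * m / (2 * \<delta>\<^sup>2)"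
    for P E m w g k n
    using nz unfolding \<delta>_def[symmetric]
    by (simp_all add: field_simps power2_eq_square power3_eq_cube)
  show "let S = Yh3 a b c c1 c2 x y; p = vector [u, t] :: real^2;
         X = x u; Y = y u; X' = deriv x u; Y' = deriv y u;
         X'' = deriv (deriv x) u; Y'' = deriv (deriv y) u
     in Gaussian_curvature S p =
          ((c1 * X' + c2 * Y') / (b * X' - a * Y'))\<^sup>2
          - (a * c1 + b * c2) * (c + c1 * X + c2 * Y) / (b * X' - a * Y')^3
            * (X'' * Y' - X' * Y'')
      \<and> mean_curvature S p =
          - ((a\<^sup>2 - b\<^sup>2) * (c + c1 * X + c2 * Y) * (X'' * Y' - X' * Y'')
             / (2 * (b * X' - a * Y')^3))
          + (a * X' - b * Y') * (c1 * X' + c2 * Y') / (b * X' - a * Y')\<^sup>2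
          - (X'\<^sup>2 - Y'\<^sup>2) * (a * c1 + b * c2) / (2 * (b * X' - a * Y')\<^sup>2)"
    unfolding Let_def Gaussian_curvature_def mean_curvature_def forms
      \<delta>_def[symmetric] K H by simp
qed

end
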